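(* Pick $i\in\{1,2,3\}$ and consider the $\mathfrak{sl}_2(\mathbb C)$-module structure on $P=\mathbb C[x,y,z,w]$ on which $E,F,H$ act as $-L_i$, $R_i$, $-\Omega-2I$ respectively. Then for $N\in\mathbb N$ the $\mathfrak{sl}_2(\mathbb C)$-submodule $\sum_{\ell\in\mathbb N}R_i^\ell\bigl({\rm Ker}(L_i)\cap P_N\bigr)$ of $P$ is an orthogonal direct sum (with respect to $\langle\,,\,\rangle$) of irreducible $\mathfrak{sl}_2(\mathbb C)$-submodules.
   Context: $\mathbb N=\{0,1,2,\ldots\}$. $\mathfrak{sl}_2(\mathbb C)$ has basis $E,F,H$ with $[H,E]=2E$, $[H,F]=-2F$, $[E,F]=H$. $P_N$ is the subspace of $P$ of homogeneous polynomials of total degree $N$. $P$ is endowed with the Hermitian form (linear in the first argument, conjugate-symmetric) for which the monomials $x^ry^sz^tw^u$ $(r,s,t,u\in\mathbb N)$ are mutually orthogonal with $\langle x^ry^sz^tw^u,x^ry^sz^tw^u\rangle=r!s!t!u!$. With $D_x,D_y,D_z,D_w$ the partial derivatives, define $L_i,R_i\in{\rm End}(P)$ by $L_1=D_xD_y-D_zD_w$, $L_2=D_xD_z-D_wD_y$, $L_3=D_xD_w-D_yD_z$; $R_1(f)=(xy-zw)f$, $R_2(f)=(xz-wy)f$, $R_3(f)=(xw-yz)f$. $\Omega\in{\rm End}(P)$ acts on each $P_N$ as $N$ times the identity $I$. *)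

theory Defs
  imports "HOL-Analysis.Analysis" "HOL-Library.Poly_Mapping"
begin

section \<open>The polynomial ring in four variables over the complex numbers\<close>

datatype vars = Vx | Vy | Vz | Vw

text \<open>A polynomial is a finitely supported map from exponent vectors to coefficients; the
  library equips this type with its convolution product.\<close>

type_synonym expo = "vars \<Rightarrow>\<^sub>0 nat"
type_synonym poly4 = "expo \<Rightarrow>\<^sub>0 complex"

definition var :: "vars \<Rightarrow> poly4" where
  "var v = Poly_Mapping.single (Poly_Mapping.single v 1) 1"

abbreviation "x_var \<equiv> var Vx"
abbreviation "y_var \<equiv> var Vy"
abbreviation "z_var \<equiv> var Vz"
abbreviation "w_var \<equiv> var Vw"

definition scale :: "complex \<Rightarrow> poly4 \<Rightarrow> poly4" where
  "scale c = Poly_Mapping.map ((*) c)"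

lemma lookup_scale [simp]: "Poly_Mapping.lookup (scale c p) m = c * Poly_Mapping.lookup p m"
  by (simp add: scale_def Poly_Mapping.map.rep_eq when_def)

text \<open>\<open>P\<close> as a complex vector space; this provides \<open>P.span\<close> and \<open>P.subspace\<close>.\<close>

interpretation P: vector_space scale
  by unfold_locales (auto intro!: poly_mapping_eqI simp: lookup_add algebra_simps)

definition expo_degree :: "expo \<Rightarrow> nat" where
  "expo_degree m = Poly_Mapping.lookup m Vx + Poly_Mapping.lookup m Vy
                 + Poly_Mapping.lookup m Vz + Poly_Mapping.lookup m Vw"

definition homogeneous :: "nat \<Rightarrow> poly4 set" where
  "homogeneous N = {p. \<forall>m\<in>Poly_Mapping.keys p. expo_degree m = N}"

text \<open>The subtraction of exponents truncates at 0, which is harmless: the coefficient vanishes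
  in that case.\<close>

definition pd :: "vars \<Rightarrow> poly4 \<Rightarrow> poly4" where
  "pd v p = (\<Sum>m\<in>Poly_Mapping.keys p.
     Poly_Mapping.single (m - Poly_Mapping.single v 1)
       (of_nat (Poly_Mapping.lookup m v) * Poly_Mapping.lookup p m))"

text \<open>The Hermitian form, linear in the first argument, for which the monomials are orthogonal
  and \<open>x\<^sup>r y\<^sup>s z\<^sup>t w\<^sup>u\<close> has square norm \<open>r! s! t! u!\<close>.\<close>

definition herm :: "poly4 \<Rightarrow> poly4 \<Rightarrow> complex" where
  "herm p q = (\<Sum>m\<in>Poly_Mapping.keys p \<inter> Poly_Mapping.keys q.
     Poly_Mapping.lookup p m * cnj (Poly_Mapping.lookup q m)
     * (fact (Poly_Mapping.lookup m Vx) * fact (Poly_Mapping.lookup m Vy)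
      * fact (Poly_Mapping.lookup m Vz) * fact (Poly_Mapping.lookup m Vw)))"

lemma herm_monomials:
  "herm (Poly_Mapping.single m 1) (Poly_Mapping.single n 1) =
    (if m = n then fact (Poly_Mapping.lookup m Vx) * fact (Poly_Mapping.lookup m Vy)
                 * fact (Poly_Mapping.lookup m Vz) * fact (Poly_Mapping.lookup m Vw) else 0)"
  by (simp add: herm_def)

lemma pd_monomial:
  "pd v (Poly_Mapping.single m c) =
    Poly_Mapping.single (m - Poly_Mapping.single v 1) (of_nat (Poly_Mapping.lookup m v) * c)"
  by (simp add: pd_def)

section \<open>The operators\<close>

text \<open>Only the indices 1, 2, 3 are meaningful.\<close>

definition opL :: "nat \<Rightarrow> poly4 \<Rightarrow> poly4" where
  "opL i f =
    (if i = 1 then pd Vx (pd Vy f) - pd Vz (pd Vw f)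
     else if i = 2 then pd Vx (pd Vz f) - pd Vw (pd Vy f)
     else if i = 3 then pd Vx (pd Vw f) - pd Vy (pd Vz f)
     else undefined)"

definition opR :: "nat \<Rightarrow> poly4 \<Rightarrow> poly4" where
  "opR i f =
    (if i = 1 then (x_var * y_var - z_var * w_var) * f
     else if i = 2 then (x_var * z_var - w_var * y_var) * f
     else if i = 3 then (x_var * w_var - y_var * z_var) * f
     else undefined)"

definition opOmega :: "poly4 \<Rightarrow> poly4" where
  "opOmega = Poly_Mapping.mapp (\<lambda>m c. of_nat (expo_degree m) * c)"

lemma opOmega_homogeneous:
  assumes "p \<in> homogeneous N"
  shows "opOmega p = scale (of_nat N) p"
  using assms
  by (intro poly_mapping_eqI)
     (auto simp: opOmega_def lookup_mapp homogeneous_def when_def in_keys_iff)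

section \<open>The Lie algebra and its modules\<close>

definition cscale_mat :: "complex \<Rightarrow> complex^2^2 \<Rightarrow> complex^2^2" where
  "cscale_mat c A = (\<chi> i j. c * A $ i $ j)"

definition sl2 :: "(complex^2^2) set" where
  "sl2 = {A. trace A = 0}"

definition lie_bracket :: "complex^2^2 \<Rightarrow> complex^2^2 \<Rightarrow> complex^2^2" where
  "lie_bracket A B = A ** B - B ** A"

definition sl2_E :: "complex^2^2" where "sl2_E = vector [vector [0, 1], vector [0, 0]]"
definition sl2_F :: "complex^2^2" where "sl2_F = vector [vector [0, 0], vector [1, 0]]"
definition sl2_H :: "complex^2^2" where "sl2_H = vector [vector [1, 0], vector [0, -1]]"

definition sl2_module :: "(complex^2^2 \<Rightarrow> poly4 \<Rightarrow> poly4) \<Rightarrow> bool" where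
  "sl2_module \<rho> \<longleftrightarrow>
     (\<forall>A\<in>sl2. Vector_Spaces.linear scale scale (\<rho> A)) \<and>
     (\<forall>A\<in>sl2. \<forall>B\<in>sl2. \<forall>p. \<rho> (A + B) p = \<rho> A p + \<rho> B p) \<and>
     (\<forall>c. \<forall>A\<in>sl2. \<forall>p. \<rho> (cscale_mat c A) p = scale c (\<rho> A p)) \<and>
     (\<forall>A\<in>sl2. \<forall>B\<in>sl2. \<forall>p. \<rho> (lie_bracket A B) p = \<rho> A (\<rho> B p) - \<rho> B (\<rho> A p))"

definition sl2_submodule :: "(complex^2^2 \<Rightarrow> poly4 \<Rightarrow> poly4) \<Rightarrow> poly4 set \<Rightarrow> bool" where
  "sl2_submodule \<rho> U \<longleftrightarrow> P.subspace U \<and> (\<forall>A\<in>sl2. \<forall>p\<in>U. \<rho> A p \<in> U)"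

definition irreducible_sl2_submodule ::
    "(complex^2^2 \<Rightarrow> poly4 \<Rightarrow> poly4) \<Rightarrow> poly4 set \<Rightarrow> bool" where
  "irreducible_sl2_submodule \<rho> U \<longleftrightarrow>
     sl2_submodule \<rho> U \<and> U \<noteq> {0} \<and>
     (\<forall>W. sl2_submodule \<rho> W \<longrightarrow> W \<subseteq> U \<longrightarrow> W = {0} \<or> W = U)"

text \<open>The linear extension of \<open>E \<mapsto> -L\<^sub>i\<close>, \<open>F \<mapsto> R\<^sub>i\<close>, \<open>H \<mapsto> -\<Omega> - 2I\<close>: a traceless matrix \<open>A\<close>
  equals \<open>A\<^sub>1\<^sub>2 E + A\<^sub>2\<^sub>1 F + A\<^sub>1\<^sub>1 H\<close>.\<close>

definition sl2_act :: "nat \<Rightarrow> complex^2^2 \<Rightarrow> poly4 \<Rightarrow> poly4" where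
  "sl2_act i A p = scale (A $ 1 $ 2) (- opL i p) + scale (A $ 2 $ 1) (opR i p)
                 + scale (A $ 1 $ 1) (- opOmega p - scale 2 p)"

lemma sl2_act_E: "sl2_act i sl2_E p = - opL i p"
  and sl2_act_F: "sl2_act i sl2_F p = opR i p"
  and sl2_act_H: "sl2_act i sl2_H p = - opOmega p - scale 2 p"
  by (simp_all add: sl2_act_def sl2_E_def sl2_F_def sl2_H_def)

lemma sl2_basis:
  assumes "A \<in> sl2"
  shows "A = cscale_mat (A $ 1 $ 2) sl2_E + cscale_mat (A $ 2 $ 1) sl2_F
           + cscale_mat (A $ 1 $ 1) sl2_H"
  using assms
  by (simp add: vec_eq_iff forall_2 sl2_def trace_def sum_2 cscale_mat_def
      sl2_E_def sl2_F_def sl2_H_def eq_neg_iff_add_eq_0 add.commute)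

lemma sl2_brackets:
  "lie_bracket sl2_H sl2_E = cscale_mat 2 sl2_E"
  "lie_bracket sl2_H sl2_F = cscale_mat (-2) sl2_F"
  "lie_bracket sl2_E sl2_F = sl2_H"
  by (simp_all add: vec_eq_iff forall_2 lie_bracket_def matrix_matrix_mult_def sum_2
      cscale_mat_def sl2_E_def sl2_F_def sl2_H_def)

section \<open>Orthogonal direct sums\<close>

text \<open>Internal direct sum of a (possibly infinite) set of subspaces. Indexing the summands by
  themselves loses nothing, since nonzero independent subspaces are distinct.\<close>

definition internal_direct_sum :: "poly4 set \<Rightarrow> poly4 set set \<Rightarrow> bool" where
  "internal_direct_sum V \<U> \<longleftrightarrow>
     (\<forall>U\<in>\<U>. P.subspace U) \<and> V = P.span (\<Union>\<U>) \<and>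
     (\<forall>\<F> u. finite \<F> \<longrightarrow> \<F> \<subseteq> \<U> \<longrightarrow> (\<forall>U\<in>\<F>. u U \<in> U) \<longrightarrow> (\<Sum>U\<in>\<F>. u U) = 0
        \<longrightarrow> (\<forall>U\<in>\<F>. u U = 0))"

definition orthogonal_direct_sum :: "poly4 set \<Rightarrow> poly4 set set \<Rightarrow> bool" where
  "orthogonal_direct_sum V \<U> \<longleftrightarrow>
     internal_direct_sum V \<U> \<and>
     (\<forall>U\<in>\<U>. \<forall>U'\<in>\<U>. U \<noteq> U' \<longrightarrow> (\<forall>p\<in>U. \<forall>q\<in>U'. herm p q = 0))"

text \<open>The sum over all \<open>\<ell>\<close> of the subspaces \<open>R\<^sub>i\<^sup>\<ell> (Ker L\<^sub>i \<inter> P\<^sub>N)\<close>, i.e. the span of their union.\<close>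

definition kernel_tower :: "nat \<Rightarrow> nat \<Rightarrow> poly4 set" where
  "kernel_tower i N = P.span (\<Union>l. (opR i ^^ l) ` ({p. opL i p = 0} \<inter> homogeneous N))"

end

theory Submission
  imports Defs
begin

text \<open>With respect to the form, multiplication by a variable is adjoint to the corresponding partial
  derivative, so \<open>R\<^sub>i\<close> is adjoint to \<open>L\<^sub>i\<close>. For \<open>v \<in> Ker L\<^sub>i \<inter> P\<^sub>N\<close> the commutator
  \<open>[L\<^sub>i, R\<^sub>i] = \<Omega> + 2I\<close> shows that \<open>L\<^sub>i R\<^sub>i\<^sup>l\<^sup>+\<^sup>1 v\<close> is a multiple of \<open>R\<^sub>i\<^sup>l v\<close>, so
  the vectors \<open>R\<^sub>i\<^sup>l v\<close> span a submodule. It is irreducible: applying \<open>L\<^sub>i\<close> repeatedly to a nonzero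
  element leads to a nonzero element of \<open>Ker L\<^sub>i\<close>, and by adjointness \<open>Ker L\<^sub>i\<close> is orthogonal to the image of
  \<open>R\<^sub>i\<close>, so that element is a multiple of \<open>v\<close>. Adjointness also shows that orthogonal vectors in \<open>Ker L\<^sub>i \<inter> P\<^sub>N\<close>
  generate orthogonal submodules, and an orthogonal basis of this finite-dimensional space gives the decomposition.\<close>

section \<open>Coefficients\<close>

text \<open>The exponent vector of the monomial \<open>var v\<close>. Writing exponents as
  \<open>unit_expo v + m\<close> avoids truncated subtraction.\<close>

definition unit_expo :: "vars \<Rightarrow> expo" where
  "unit_expo v = Poly_Mapping.single v 1"

lemma lookup_unit_expo [simp]: "Poly_Mapping.lookup (unit_expo v) u = (if u = v then 1 else 0)"
  by (auto simp: unit_expo_def lookup_single when_def)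

text \<open>Addition of exponents is cancellative, so a single pair of exponents contributes to the
  convolution at \<open>k + m\<close>.\<close>

lemma lookup_single_mult:
  fixes p :: poly4
  shows "Poly_Mapping.lookup (Poly_Mapping.single k 1 * p) (k + m) = Poly_Mapping.lookup p m"
proof -
  have "Poly_Mapping.lookup (Poly_Mapping.single k 1 * p) (k + m) =
    (\<Sum>l. (\<Sum>q. Poly_Mapping.lookup p q when k + m = l + q) when k = l)"
    by (simp add: lookup_mult lookup_single when_mult)
  also have "\<dots> = (\<Sum>q. Poly_Mapping.lookup p q when m = q)"
    by simp
  finally show ?thesis by simp
qed

lemma expo_split:
  fixes m :: expo
  assumes "Poly_Mapping.lookup m v \<noteq> 0"
  obtains n where "m = unit_expo v + n"
proof
  show "m = unit_expo v + (m - unit_expo v)"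
    using assms
    by (intro poly_mapping_eqI) (auto simp: lookup_add lookup_minus)
qed

lemma lookup_var_mult_add:
  "Poly_Mapping.lookup (var v * p) (unit_expo v + m) = Poly_Mapping.lookup p m"
  unfolding var_def unit_expo_def[symmetric] by (rule lookup_single_mult)

lemma lookup_var_mult_zero:
  assumes "Poly_Mapping.lookup m v = 0"
  shows "Poly_Mapping.lookup (var v * p) m = 0"
proof (rule ccontr)
  assume "\<not> ?thesis"
  then have "m \<in> Poly_Mapping.keys (var v * p)" by (simp add: in_keys_iff)
  then obtain n where "m = unit_expo v + n"
    using keys_mult[of "var v" p] by (auto simp: var_def unit_expo_def)
  with assms show False by (simp add: lookup_add)
qed

lemma lookup_var_mult:
  "Poly_Mapping.lookup (var v * p) m =
    (if Poly_Mapping.lookup m v = 0 then 0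
     else Poly_Mapping.lookup p (m - unit_expo v))"
proof (cases "Poly_Mapping.lookup m v = 0")
  case False
  then obtain n where "m = unit_expo v + n" by (rule expo_split)
  then show ?thesis by (simp add: lookup_var_mult_add lookup_add)
qed (simp add: lookup_var_mult_zero)

text \<open>Only the exponent \<open>unit_expo v + m\<close> contributes at \<open>m\<close>: an
  exponent without \<open>v\<close>, where the subtraction in \<open>pd\<close> truncates, carries
  the factor 0.\<close>

lemma lookup_pd:
  "Poly_Mapping.lookup (pd v p) m =
    of_nat (Suc (Poly_Mapping.lookup m v)) * Poly_Mapping.lookup p (unit_expo v + m)"
    (is "?l = ?r")
proof -
  let ?t = "\<lambda>n. Poly_Mapping.lookup (Poly_Mapping.single (n - unit_expo v)
       (of_nat (Poly_Mapping.lookup n v) * Poly_Mapping.lookup p n)) m"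
  have t0: "?t n = 0" if "n \<noteq> unit_expo v + m" for n
  proof (cases "Poly_Mapping.lookup n v = 0")
    case False
    then obtain k where "n = unit_expo v + k" by (rule expo_split)
    with that show ?thesis by (auto simp: lookup_single when_def)
  qed simp
  have "?l = (\<Sum>n\<in>Poly_Mapping.keys p. ?t n)"
    by (simp add: pd_def lookup_sum unit_expo_def)
  also have "\<dots> = (\<Sum>n\<in>{unit_expo v + m}. ?t n)"
  proof (cases "unit_expo v + m \<in> Poly_Mapping.keys p")
    case True
    then show ?thesis by (intro sum.mono_neutral_right) (use t0 in auto)
  next
    case False
    then have "?t (unit_expo v + m) = 0" by (simp add: in_keys_iff)
    moreover have "(\<Sum>n\<in>Poly_Mapping.keys p. ?t n) = 0"
      by (intro sum.neutral ballI t0) (use False in auto)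
    ultimately show ?thesis by simp
  qed
  also have "\<dots> = ?r" by (simp add: lookup_add)
  finally show ?thesis .
qed

lemma lookup_opOmega:
  "Poly_Mapping.lookup (opOmega p) m = of_nat (expo_degree m) * Poly_Mapping.lookup p m"
  by (simp add: opOmega_def lookup_mapp when_def in_keys_iff)

lemma scale_two: "scale 2 p = 2 * p"
  using P.scale_left_distrib[of 1 1 p] by simp

lemma lookup_two_mult: "Poly_Mapping.lookup (2 * p :: poly4) m = 2 * Poly_Mapping.lookup p m"
  by (simp flip: scale_two)

section \<open>The Weyl algebra\<close>

lemma pd_add: "pd v (p + q) = pd v p + pd v q"
  by (intro poly_mapping_eqI) (simp add: lookup_pd lookup_add algebra_simps)

lemma pd_diff: "pd v (p - q) = pd v p - pd v q"
  by (intro poly_mapping_eqI) (simp add: lookup_pd lookup_minus algebra_simps)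

lemma pd_scale: "pd v (scale c p) = scale c (pd v p)"
  by (intro poly_mapping_eqI) (simp add: lookup_pd)

lemma var_mult_scale: "var v * scale c p = scale c (var v * p)"
  by (intro poly_mapping_eqI) (simp add: lookup_var_mult)

lemma pd_commute: "pd u (pd v p) = pd v (pd u p)"
  by (intro poly_mapping_eqI)
    (simp add: lookup_pd lookup_add add.left_commute)

lemma pd_var_mult_same: "pd v (var v * p) = p + var v * pd v p"
proof (intro poly_mapping_eqI)
  fix m
  show "Poly_Mapping.lookup (pd v (var v * p)) m = Poly_Mapping.lookup (p + var v * pd v p) m"
  proof (cases "Poly_Mapping.lookup m v = 0")
    case True
    then show ?thesis by (simp add: lookup_pd lookup_add lookup_var_mult_add lookup_var_mult_zero)
  next
    case False
    then obtain n where "m = unit_expo v + n" by (rule expo_split)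
    then show ?thesis by (simp add: lookup_pd lookup_add lookup_var_mult_add distrib_right)
  qed
qed

lemma pd_var_mult_other:
  assumes "u \<noteq> v"
  shows "pd u (var v * p) = var v * pd u p"
proof (intro poly_mapping_eqI)
  fix m
  show "Poly_Mapping.lookup (pd u (var v * p)) m = Poly_Mapping.lookup (var v * pd u p) m"
  proof (cases "Poly_Mapping.lookup m v = 0")
    case True
    then show ?thesis using assms
      by (simp add: lookup_pd lookup_add lookup_var_mult_zero)
  next
    case False
    then obtain n where "m = unit_expo v + n" by (rule expo_split)
    then show ?thesis using assms
      by (simp add: lookup_pd lookup_add lookup_var_mult_add
          add.left_commute[of "unit_expo u"])
  qed
qed

lemma lookup_var_mult_pd:
  "Poly_Mapping.lookup (var v * pd v p) m = of_nat (Poly_Mapping.lookup m v) * Poly_Mapping.lookup p m"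
proof (cases "Poly_Mapping.lookup m v = 0")
  case False
  then obtain n where "m = unit_expo v + n" by (rule expo_split)
  then show ?thesis by (simp add: lookup_var_mult_add lookup_pd lookup_add)
qed (simp add: lookup_var_mult_zero)

text \<open>Euler's identity: \<open>var v * pd v\<close> multiplies each monomial by its exponent
  in \<open>v\<close>. The order of the variables is left open because it varies with the index of
  the operators.\<close>

lemma euler:
  assumes "distinct [a, b, c, d]"
  shows "opOmega p = var a * pd a p + var b * pd b p + var c * pd c p + var d * pd d p"
proof (intro poly_mapping_eqI)
  fix m
  have "expo_degree m = Poly_Mapping.lookup m a + Poly_Mapping.lookup m b
     + Poly_Mapping.lookup m c + Poly_Mapping.lookup m d"
    using assms by (cases a; cases b; cases c; cases d) (simp_all add: expo_degree_def)
  then show "Poly_Mapping.lookup (opOmega p) m = Poly_Mapping.lookup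
     (var a * pd a p + var b * pd b p + var c * pd c p + var d * pd d p) m"
    by (simp add: lookup_add lookup_var_mult_pd lookup_opOmega algebra_simps)
qed

lemma expo_degree_single_add: "expo_degree (unit_expo v + m) = Suc (expo_degree m)"
  by (cases v) (simp_all add: expo_degree_def lookup_add)

lemma opOmega_var_mult: "opOmega (var v * p) = var v * opOmega p + var v * p"
proof (intro poly_mapping_eqI)
  fix m
  show "Poly_Mapping.lookup (opOmega (var v * p)) m =
    Poly_Mapping.lookup (var v * opOmega p + var v * p) m"
  proof (cases "Poly_Mapping.lookup m v = 0")
    case False
    then obtain n where "m = unit_expo v + n" by (rule expo_split)
    then show ?thesis
      using expo_degree_single_add[of v n] lookup_var_mult_add[of v]
      by (simp add: lookup_opOmega lookup_add algebra_simps)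
  qed (simp add: lookup_opOmega lookup_add lookup_var_mult_zero)
qed

lemma opOmega_pd: "opOmega (pd v p) = pd v (opOmega p) - pd v p"
proof (intro poly_mapping_eqI)
  fix m
  show "Poly_Mapping.lookup (opOmega (pd v p)) m = Poly_Mapping.lookup (pd v (opOmega p) - pd v p) m"
    using expo_degree_single_add[of v m]
    by (simp add: lookup_opOmega lookup_pd lookup_minus algebra_simps)
qed

lemma opOmega_add: "opOmega (p + q) = opOmega p + opOmega q"
  by (intro poly_mapping_eqI) (simp add: lookup_opOmega lookup_add algebra_simps)

lemma opOmega_diff: "opOmega (p - q) = opOmega p - opOmega q"
  by (intro poly_mapping_eqI) (simp add: lookup_opOmega lookup_minus algebra_simps)

lemma opOmega_scale: "opOmega (scale c p) = scale c (opOmega p)"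
  by (intro poly_mapping_eqI) (simp add: lookup_opOmega)

section \<open>The Hermitian form\<close>

definition weight :: "expo \<Rightarrow> complex" where
  "weight m = fact (Poly_Mapping.lookup m Vx) * fact (Poly_Mapping.lookup m Vy)
    * fact (Poly_Mapping.lookup m Vz) * fact (Poly_Mapping.lookup m Vw)"

text \<open>The recursion for factorials. Its factor is the one that \<open>pd v\<close> produces,
  which is why \<open>var v\<close> and \<open>pd v\<close> are adjoint.\<close>

lemma weight_single_add:
  "weight (unit_expo v + m) = of_nat (Suc (Poly_Mapping.lookup m v)) * weight m"
  by (cases v) (simp_all add: weight_def lookup_add algebra_simps)

lemma weight_eq_of_real: "\<exists>r>0. weight m = of_real r"
  by (intro exI[of _ "fact (Poly_Mapping.lookup m Vx) * fact (Poly_Mapping.lookup m Vy)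
    * fact (Poly_Mapping.lookup m Vz) * fact (Poly_Mapping.lookup m Vw)"]) (simp add: weight_def)

text \<open>Enlarging the index set adds only zero terms. An index set depending on one argument
  makes linearity in the other immediate.\<close>

lemma herm_sum_left:
  "herm p q = (\<Sum>m\<in>Poly_Mapping.keys p.
     Poly_Mapping.lookup p m * cnj (Poly_Mapping.lookup q m) * weight m)"
  unfolding herm_def weight_def
  by (rule sum.mono_neutral_left) (auto simp: in_keys_iff)

lemma herm_sum_right:
  "herm p q = (\<Sum>m\<in>Poly_Mapping.keys q.
     Poly_Mapping.lookup p m * cnj (Poly_Mapping.lookup q m) * weight m)"
  unfolding herm_def weight_def
  by (rule sum.mono_neutral_left) (auto simp: in_keys_iff)

lemma cnj_weight [simp]: "cnj (weight m) = weight m"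
  by (simp add: weight_def)

lemma herm_cnj: "herm p q = cnj (herm q p)"
  by (subst herm_sum_left, subst herm_sum_right) (simp add: mult.commute)

lemma herm_add_left: "herm (p + p') q = herm p q + herm p' q"
  by (simp add: herm_sum_right lookup_add algebra_simps sum.distrib)

lemma herm_diff_left: "herm (p - p') q = herm p q - herm p' q"
  by (simp add: herm_sum_right lookup_minus algebra_simps sum_subtractf)

lemma herm_scale_left: "herm (scale c p) q = c * herm p q"
  by (simp add: herm_sum_right sum_distrib_left mult.assoc)

lemma herm_zero_left [simp]: "herm 0 q = 0"
  by (simp add: herm_sum_right)

lemma herm_zero_right [simp]: "herm q 0 = 0"
  by (simp add: herm_sum_right)

lemma herm_add_right: "herm q (p + p') = herm q p + herm q p'"
  by (subst (1 2 3) herm_cnj) (simp add: herm_add_left)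

lemma herm_diff_right: "herm q (p - p') = herm q p - herm q p'"
  by (subst (1 2 3) herm_cnj) (simp add: herm_diff_left)

lemma herm_scale_right: "herm q (scale c p) = cnj c * herm q p"
  by (subst (1 2) herm_cnj) (simp add: herm_scale_left)

lemma herm_sum_fun_left: "herm (\<Sum>x\<in>A. f x) q = (\<Sum>x\<in>A. herm (f x) q)"
  by (induction A rule: infinite_finite_induct) (simp_all add: herm_add_left)

text \<open>\<open>herm p p\<close> is a sum of squared moduli of the coefficients with positive
  real weights, so each coefficient vanishes.\<close>

lemma herm_definite:
  assumes "herm p p = 0"
  shows "p = 0"
proof -
  define r where "r m = (SOME r. r > 0 \<and> weight m = of_real r)" for m
  have r: "r m > 0" "weight m = of_real (r m)" for m
    using someI_ex[OF weight_eq_of_real[of m, unfolded Bex_def]] by (auto simp: r_def)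
  have "of_real (\<Sum>m\<in>Poly_Mapping.keys p. (cmod (Poly_Mapping.lookup p m))\<^sup>2 * r m) = herm p p"
    by (simp add: herm_sum_left r(2) complex_norm_square[symmetric])
  then have "(\<Sum>m\<in>Poly_Mapping.keys p. (cmod (Poly_Mapping.lookup p m))\<^sup>2 * r m) = 0"
    using assms of_real_eq_0_iff by metis
  moreover have "(cmod (Poly_Mapping.lookup p m))\<^sup>2 * r m \<ge> 0" for m
    using r(1)[of m] by simp
  ultimately have "\<forall>m\<in>Poly_Mapping.keys p. (cmod (Poly_Mapping.lookup p m))\<^sup>2 * r m = 0"
    by (simp add: sum_nonneg_eq_0_iff)
  then have "Poly_Mapping.lookup p m = 0" for m
    using r(1)[of m] by (cases "m \<in> Poly_Mapping.keys p") (auto simp: in_keys_iff)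
  then show ?thesis by (intro poly_mapping_eqI) simp
qed

text \<open>Multiplication by \<open>var v\<close> shifts the support by \<open>unit_expo v\<close>;
  after reindexing, the change of the weight is the coefficient produced by
  \<open>pd v\<close>.\<close>

lemma herm_var_mult: "herm (var v * p) q = herm p (pd v q)"
proof -
  let ?e = "unit_expo v"
  have keys: "Poly_Mapping.keys (var v * p) = (+) ?e ` Poly_Mapping.keys p"
  proof (intro set_eqI iffI)
    fix m assume "m \<in> Poly_Mapping.keys (var v * p)"
    then have nz: "Poly_Mapping.lookup (var v * p) m \<noteq> 0" by (simp add: in_keys_iff)
    then have "Poly_Mapping.lookup m v \<noteq> 0" by (metis lookup_var_mult_zero)
    then obtain n where n: "m = ?e + n" by (rule expo_split)
    with nz show "m \<in> (+) ?e ` Poly_Mapping.keys p"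
      by (auto simp: lookup_var_mult_add in_keys_iff)
  next
    fix m assume "m \<in> (+) ?e ` Poly_Mapping.keys p"
    then show "m \<in> Poly_Mapping.keys (var v * p)"
      using lookup_var_mult_add[of v p] by (auto simp: in_keys_iff)
  qed
  have "herm (var v * p) q = (\<Sum>m\<in>Poly_Mapping.keys p. Poly_Mapping.lookup (var v * p) (?e + m)
      * cnj (Poly_Mapping.lookup q (?e + m)) * weight (?e + m))"
    unfolding herm_sum_left keys by (subst sum.reindex) (simp_all add: inj_on_def)
  also have "\<dots> = herm p (pd v q)"
    unfolding herm_sum_left lookup_var_mult_add weight_single_add lookup_pd
    by (rule sum.cong) (simp_all add: algebra_simps)
  finally show ?thesis .
qed

section \<open>Orthogonal spanning sets of spaces of homogeneous polynomials\<close>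

lemma herm_span_eq_zero:
  assumes "\<And>p q. p \<in> S \<Longrightarrow> q \<in> T \<Longrightarrow> herm p q = 0"
    and "p \<in> P.span S" "q \<in> P.span T"
  shows "herm p q = 0"
proof -
  have "herm p q = 0" if "p \<in> P.span S" "q \<in> T" for p q
    using that(1) by (induction rule: P.span_induct_alt)
      (simp_all add: herm_add_left herm_scale_left assms(1) that(2))
  with assms(3,2) show ?thesis
    by (induction rule: P.span_induct_alt) (simp_all add: herm_add_right herm_scale_right)
qed

text \<open>Gram-Schmidt without normalisation. Zero vectors are discarded on the way, so by
  definiteness no divisor \<open>herm t t\<close> vanishes.\<close>

lemma orthogonal_spanning_set:
  assumes "finite S"
  shows "\<exists>T. finite T \<and> 0 \<notin> T \<and> P.span T = P.span S \<and> (\<forall>s\<in>T. \<forall>t\<in>T. s \<noteq> t \<longrightarrow> herm s t = 0)"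
  using assms
proof (induction S)
  case empty
  show ?case by (intro exI[of _ "{}"]) simp
next
  case (insert a S)
  from insert.IH obtain T where T: "finite T" "0 \<notin> T" "P.span T = P.span S"
    and orthT: "\<forall>s\<in>T. \<forall>t\<in>T. s \<noteq> t \<longrightarrow> herm s t = 0"
    by (elim exE conjE) (rule that)
  define b where "b = a - (\<Sum>t\<in>T. scale (herm a t / herm t t) t)"
  have orth: "herm b s = 0" if s: "s \<in> T" for s
  proof -
    have "herm (\<Sum>t\<in>T. scale (herm a t / herm t t) t) s = (\<Sum>t\<in>T. if t = s then herm a s else 0)"
      unfolding herm_sum_fun_left using T(2) orthT s herm_definite
      by (intro sum.cong) (auto simp: herm_scale_left)
    then show ?thesis by (simp add: b_def herm_diff_left s T(1))
  qed
  \<comment> \<open>The correction lies in the span of \<open>T\<close>, so exchanging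
    \<open>a\<close> for \<open>b\<close> keeps the span.\<close>
  have "a - b \<in> P.span T"
    unfolding b_def diff_diff_eq2 add_diff_cancel_left' by (intro P.span_sum P.span_scale P.span_base)
  then have "P.span (insert a T) = P.span (insert b T)" by (rule P.eq_span_insert_eq)
  moreover have "P.span (insert a T) = P.span (insert a S)"
    using T(3) by (simp add: P.span_insert)
  ultimately have span: "P.span (insert b T) = P.span (insert a S)" by simp
  show ?case
  proof (cases "b = 0")
    case True
    with span T orthT show ?thesis by (intro exI[of _ T]) (auto simp: P.span_insert_0)
  next
    case False
    moreover have "herm s b = 0" if "s \<in> T" for s
      using orth[OF that] herm_cnj[of s b] by simp
    ultimately show ?thesis using span T orthT orth by (intro exI[of _ "insert b T"]) auto
  qed
qed

text \<open>The four exponents are bounded by \<open>N\<close> and determine the exponent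
  vector.\<close>

lemma finite_expo_degree: "finite {m. expo_degree m = N}"
proof (rule finite_imageD)
  let ?f = "\<lambda>m::expo. (Poly_Mapping.lookup m Vx, Poly_Mapping.lookup m Vy,
    Poly_Mapping.lookup m Vz, Poly_Mapping.lookup m Vw)"
  have "?f ` {m. expo_degree m = N} \<subseteq> {..N} \<times> {..N} \<times> {..N} \<times> {..N}"
    by (auto simp: expo_degree_def)
  then show "finite (?f ` {m. expo_degree m = N})"
    by (rule finite_subset) auto
  show "inj_on ?f {m. expo_degree m = N}"
  proof (rule inj_onI)
    fix m n :: expo assume "?f m = ?f n"
    then have "Poly_Mapping.lookup m v = Poly_Mapping.lookup n v" for v by (cases v) auto
    then show "m = n" by (rule poly_mapping_eqI)
  qed
qed

lemma homogeneous_subset_span: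
  "homogeneous N \<subseteq> P.span ((\<lambda>m. Poly_Mapping.single m 1) ` {m. expo_degree m = N})"
proof
  fix p assume p: "p \<in> homogeneous N"
  have "p = (\<Sum>m\<in>Poly_Mapping.keys p. scale (Poly_Mapping.lookup p m) (Poly_Mapping.single m 1))"
    by (intro poly_mapping_eqI) (auto simp: lookup_sum lookup_single when_def in_keys_iff
        if_distrib[of "(*) _"] cong: if_cong)
  also have "\<dots> \<in> P.span ((\<lambda>m. Poly_Mapping.single m 1) ` {m. expo_degree m = N})"
    using p by (intro P.span_sum P.span_scale P.span_base) (auto simp: homogeneous_def)
  finally show "p \<in> P.span ((\<lambda>m. Poly_Mapping.single m 1) ` {m. expo_degree m = N})" .
qed

text \<open>A maximal independent subset of \<open>K\<close> is finite, since it lies in the span of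
  finitely many monomials; Gram-Schmidt then applies to it.\<close>

lemma orthogonal_basis_homogeneous:
  assumes "P.subspace K" "K \<subseteq> homogeneous N"
  obtains T where "0 \<notin> T" "P.span T = K" "\<And>s t. s \<in> T \<Longrightarrow> t \<in> T \<Longrightarrow> s \<noteq> t \<Longrightarrow> herm s t = 0"
proof -
  obtain B where B: "B \<subseteq> K" "P.independent B" "K \<subseteq> P.span B"
    by (rule P.maximal_independent_subset)
  have fin: "finite B"
    using P.independent_span_bound[OF finite_imageI[OF finite_expo_degree[of N]] B(2)]
      B(1) assms(2) homogeneous_subset_span[of N] by blast
  have span: "P.span B = K"
    using B assms(1) P.span_subspace by blast
  from orthogonal_spanning_set[OF fin] obtain T where "0 \<notin> T" "P.span T = P.span B"
    and "\<forall>s\<in>T. \<forall>t\<in>T. s \<noteq> t \<longrightarrow> herm s t = 0"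
    by (elim exE conjE) (rule that)
  then show ?thesis by (intro that[of T]) (simp_all add: span)
qed

lemma subspace_homogeneous: "P.subspace (homogeneous N)"
  using keys_add by (fastforce simp: P.subspace_def homogeneous_def in_keys_iff lookup_add)


section \<open>The module structure\<close>

text \<open>The coordinates of the bracket along H, E and F, with the entry at (2,2) eliminated by
  tracelessness.\<close>

lemma lie_bracket_entries:
  assumes "A \<in> sl2" "B \<in> sl2"
  shows "lie_bracket A B $ 1 $ 1 = A $ 1 $ 2 * B $ 2 $ 1 - A $ 2 $ 1 * B $ 1 $ 2"
    "lie_bracket A B $ 1 $ 2 = 2 * (A $ 1 $ 1 * B $ 1 $ 2 - A $ 1 $ 2 * B $ 1 $ 1)"
    "lie_bracket A B $ 2 $ 1 = 2 * (A $ 2 $ 1 * B $ 1 $ 1 - A $ 1 $ 1 * B $ 2 $ 1)"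
proof -
  have "A $ 2 $ 2 = - A $ 1 $ 1" "B $ 2 $ 2 = - B $ 1 $ 1"
    using assms by (simp_all add: sl2_def trace_def sum_2 eq_neg_iff_add_eq_0 add.commute)
  then show "lie_bracket A B $ 1 $ 1 = A $ 1 $ 2 * B $ 2 $ 1 - A $ 2 $ 1 * B $ 1 $ 2"
    "lie_bracket A B $ 1 $ 2 = 2 * (A $ 1 $ 1 * B $ 1 $ 2 - A $ 1 $ 2 * B $ 1 $ 1)"
    "lie_bracket A B $ 2 $ 1 = 2 * (A $ 2 $ 1 * B $ 1 $ 1 - A $ 1 $ 1 * B $ 2 $ 1)"
    by (simp_all add: lie_bracket_def matrix_matrix_mult_def sum_2 algebra_simps)
qed

locale sl2_index =
  fixes i :: nat
  assumes index: "i \<in> {1, 2, 3}"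
begin

text \<open>The three pairs of operators differ only by a renaming of the variables, so each
  identity is proved once for four distinct variables.\<close>

lemma operators:
  obtains a b c d where "distinct [a, b, c, d]"
    "\<And>f. opL i f = pd a (pd b f) - pd c (pd d f)"
    "\<And>f. opR i f = var a * (var b * f) - var c * (var d * f)"
proof -
  from index consider "i = 1" | "i = 2" | "i = 3" by auto
  then show ?thesis
  proof cases
    case 1
    show ?thesis by (rule that[of Vx Vy Vz Vw]) (simp_all add: 1 opL_def opR_def algebra_simps)
  next
    case 2
    show ?thesis by (rule that[of Vx Vz Vw Vy]) (simp_all add: 2 opL_def opR_def algebra_simps)
  next
    case 3
    show ?thesis by (rule that[of Vx Vw Vy Vz]) (simp_all add: 3 opL_def opR_def algebra_simps)
  qed
qed

sublocale L: Vector_Spaces.linear scale scale "opL i"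
proof -
  obtain a b c d where op: "\<And>f. opL i f = pd a (pd b f) - pd c (pd d f)"
    by (rule operators) blast
  show "Vector_Spaces.linear scale scale (opL i)"
    by unfold_locales (simp_all add: op pd_add pd_scale P.scale_right_diff_distrib)
qed

sublocale R: Vector_Spaces.linear scale scale "opR i"
proof -
  obtain a b c d where op: "\<And>f. opR i f = var a * (var b * f) - var c * (var d * f)"
    by (rule operators) blast
  show "Vector_Spaces.linear scale scale (opR i)"
    by unfold_locales (simp_all add: op distrib_left var_mult_scale P.scale_right_diff_distrib)
qed

lemma herm_opR_left: "herm (opR i p) q = herm p (opL i q)"
proof -
  obtain a b c d where "\<And>f. opL i f = pd a (pd b f) - pd c (pd d f)"
    "\<And>f. opR i f = var a * (var b * f) - var c * (var d * f)"
    by (rule operators) blast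
  then show ?thesis
    by (simp add: herm_diff_left herm_diff_right herm_var_mult pd_commute)
qed

text \<open>The relation [E,F] = H. The product rule gives the commutator of
  \<open>pd a pd b\<close> with \<open>ab\<close> as \<open>a pd a + b pd b + 1\<close>, and
  likewise for \<open>c\<close>, \<open>d\<close>; the cross terms commute. Euler's identity sums
  the result.\<close>

lemma opL_opR: "opL i (opR i p) = opR i (opL i p) + opOmega p + scale 2 p"
proof -
  obtain a b c d where d: "distinct [a, b, c, d]"
    and op: "\<And>f. opL i f = pd a (pd b f) - pd c (pd d f)"
    "\<And>f. opR i f = var a * (var b * f) - var c * (var d * f)"
    by (rule operators) blast
  have d_sym: "b \<noteq> a" "c \<noteq> a" "d \<noteq> a" "c \<noteq> b" "d \<noteq> b" "d \<noteq> c"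
    using d by auto
  have comm: "pd b (pd a f) = pd a (pd b f)" "pd d (pd c f) = pd c (pd d f)"
    "pd c (pd d (pd a (pd b f))) = pd a (pd b (pd c (pd d f)))" for f
    by (simp_all only: pd_commute[of b a] pd_commute[of d c] pd_commute[of c a] pd_commute[of d a]
        pd_commute[of c b] pd_commute[of d b])
  have "opL i (opR i p) - opR i (opL i p) =
     var a * pd a p + var b * pd b p + var c * pd c p + var d * pd d p + (p + p)"
    using d by (simp add: d_sym op pd_diff pd_add pd_var_mult_same pd_var_mult_other comm
        distrib_left right_diff_distrib)
  then show ?thesis by (simp add: euler[OF d] scale_two algebra_simps)
qed

text \<open>This and the next lemma are the relations [H,F] = -2F and [H,E] = 2E:
  \<open>opR i\<close> raises the degree by two and \<open>opL i\<close> lowers it by two.\<close>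

lemma opOmega_opR: "opOmega (opR i p) = opR i (opOmega p) + scale 2 (opR i p)"
proof -
  obtain a b c d where op: "\<And>f. opR i f = var a * (var b * f) - var c * (var d * f)"
    by (rule operators) blast
  show ?thesis
    by (simp add: op opOmega_diff opOmega_var_mult distrib_left right_diff_distrib scale_two)
qed

lemma opOmega_opL: "opOmega (opL i p) = opL i (opOmega p) - scale 2 (opL i p)"
proof -
  obtain a b c d where op: "\<And>f. opL i f = pd a (pd b f) - pd c (pd d f)"
    by (rule operators) blast
  show ?thesis
    by (simp add: op opOmega_diff opOmega_pd pd_diff scale_two algebra_simps)
qed

lemma sl2_act_add: "sl2_act i A (p + q) = sl2_act i A p + sl2_act i A q"
  by (simp add: sl2_act_def L.add R.add opOmega_add algebra_simps)

lemma sl2_act_scale: "sl2_act i A (scale c p) = scale c (sl2_act i A p)"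
  by (intro poly_mapping_eqI)
    (simp add: sl2_act_def L.scale R.scale opOmega_scale lookup_add lookup_minus algebra_simps)

text \<open>Both sides are expanded in the entries of \<open>A\<close> and \<open>B\<close>; the
  three commutation relations bring the operators into a common order.\<close>

lemma sl2_act_bracket:
  assumes "A \<in> sl2" "B \<in> sl2"
  shows "sl2_act i (lie_bracket A B) p = sl2_act i A (sl2_act i B p) - sl2_act i B (sl2_act i A p)"
  by (intro poly_mapping_eqI)
    (simp add: sl2_act_def lie_bracket_entries[OF assms] L.add R.add L.diff R.diff L.neg R.neg
      L.scale R.scale opOmega_add opOmega_diff opOmega_scale opOmega_opR opOmega_opL opL_opR
      lookup_add lookup_minus lookup_two_mult algebra_simps)

lemma sl2_module_act: "sl2_module (sl2_act i)"
proof -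
  have "Vector_Spaces.linear scale scale (sl2_act i A)" for A
    by unfold_locales (simp_all add: sl2_act_add sl2_act_scale)
  moreover have "sl2_act i (A + B) p = sl2_act i A p + sl2_act i B p" for A B p
    by (simp add: sl2_act_def algebra_simps)
  moreover have "sl2_act i (cscale_mat c A) p = scale c (sl2_act i A p)" for c A p
    by (intro poly_mapping_eqI)
      (simp add: sl2_act_def cscale_mat_def lookup_add lookup_minus algebra_simps)
  ultimately show ?thesis by (simp add: sl2_module_def sl2_act_bracket)
qed

lemma sl2_submodule_span:
  assumes "\<And>s. s \<in> S \<Longrightarrow> opL i s \<in> P.span S" "\<And>s. s \<in> S \<Longrightarrow> opR i s \<in> P.span S"
    "\<And>s. s \<in> S \<Longrightarrow> opOmega s \<in> P.span S"
  shows "sl2_submodule (sl2_act i) (P.span S)"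
proof -
  have "sl2_act i A p \<in> P.span S" if "p \<in> P.span S" for A p
    using that
  proof (induction rule: P.span_induct_alt)
    case base
    show ?case using sl2_act_scale[of A 0 0] by (simp add: P.span_zero)
  next
    case (step c x y)
    then have "sl2_act i A x \<in> P.span S"
      unfolding sl2_act_def
      by (intro P.span_add P.span_scale P.span_diff P.span_neg assms P.span_base)
    with step show ?case by (simp add: sl2_act_add sl2_act_scale P.span_add P.span_scale)
  qed
  then show ?thesis by (simp add: sl2_submodule_def)
qed

lemma sl2_submodule_opL:
  assumes "sl2_submodule (sl2_act i) W" "w \<in> W"
  shows "opL i w \<in> W"
proof -
  have "sl2_E \<in> sl2" by (simp add: sl2_def sl2_E_def trace_def sum_2)
  with assms have "- opL i w \<in> W" unfolding sl2_submodule_def by (metis sl2_act_E)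
  then show ?thesis using assms(1) P.subspace_neg[of W "- opL i w"]
    by (simp add: sl2_submodule_def)
qed

lemma sl2_submodule_opR_power:
  assumes "sl2_submodule (sl2_act i) W" "w \<in> W"
  shows "(opR i ^^ l) w \<in> W"
proof (induction l)
  case (Suc l)
  have "sl2_F \<in> sl2" by (simp add: sl2_def sl2_F_def trace_def sum_2)
  with assms(1) Suc show ?case unfolding sl2_submodule_def by (metis sl2_act_F funpow.simps(2) o_apply)
qed (simp add: assms(2))

section \<open>Submodules generated by vectors in the kernel\<close>

text \<open>Since E acts as \<open>- opL i\<close>, the nonzero elements are the highest weight
  vectors of weight -N-2; they are lowest with respect to the degree.\<close>

definition lowest :: "nat \<Rightarrow> poly4 set" where
  "lowest N = {p. opL i p = 0} \<inter> homogeneous N"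

text \<open>For \<open>v\<close> in some \<open>lowest N\<close>, this is the submodule generated by
  \<open>v\<close>.\<close>

definition ladder :: "poly4 \<Rightarrow> poly4 set" where
  "ladder v = P.span (range (\<lambda>l. (opR i ^^ l) v))"

lemma subspace_lowest: "P.subspace (lowest N)"
  unfolding lowest_def by (intro P.subspace_inter L.subspace_kernel subspace_homogeneous)

lemma opOmega_opR_power:
  assumes "v \<in> lowest N"
  shows "opOmega ((opR i ^^ l) v) = scale (of_nat (N + 2 * l)) ((opR i ^^ l) v)"
proof (induction l)
  case 0
  show ?case using assms by (simp add: lowest_def opOmega_homogeneous)
next
  case (Suc l)
  have "opOmega ((opR i ^^ Suc l) v) = scale (of_nat (N + 2 * l) + 2) ((opR i ^^ Suc l) v)"
    by (simp only: funpow.simps o_apply opOmega_opR Suc R.scale P.scale_left_distrib)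
  also have "of_nat (N + 2 * l) + 2 = (of_nat (N + 2 * Suc l) :: complex)"
    by simp
  finally show ?case .
qed

text \<open>Each passage of \<open>opL i\<close> across a factor \<open>opR i\<close> adds the
  degree plus 2 of the vector behind it. The coefficient is the sum of N + 2k + 2 over k from 0 to
  l.\<close>

lemma opL_opR_power:
  assumes "v \<in> lowest N"
  shows "opL i ((opR i ^^ Suc l) v) = scale (of_nat (Suc l * (N + l + 2))) ((opR i ^^ l) v)"
proof (induction l)
  case 0
  have "opL i ((opR i ^^ Suc 0) v) = scale (of_nat N) v + scale 2 v"
    using assms opOmega_opR_power[OF assms, of 0] by (simp add: opL_opR lowest_def R.zero)
  also have "\<dots> = scale (of_nat N + 2) v"
    by (rule P.scale_left_distrib[symmetric])
  finally show ?case by simp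
next
  case (Suc l)
  have "opL i ((opR i ^^ Suc (Suc l)) v) = opR i (opL i ((opR i ^^ Suc l) v))
     + opOmega ((opR i ^^ Suc l) v) + scale 2 ((opR i ^^ Suc l) v)"
    by (simp add: opL_opR)
  also have "\<dots> = scale (of_nat (Suc l * (N + l + 2)) + of_nat (N + 2 * Suc l) + 2) ((opR i ^^ Suc l) v)"
    unfolding Suc opOmega_opR_power[OF assms]
    by (simp only: funpow.simps o_apply R.scale P.scale_left_distrib)
  also have "of_nat (Suc l * (N + l + 2)) + of_nat (N + 2 * Suc l) + 2
      = (of_nat (Suc (Suc l) * (N + Suc l + 2)) :: complex)"
    by (simp add: algebra_simps)
  finally show ?case .
qed

text \<open>Stated for a set \<open>K\<close> to cover both a single ladder, \<open>K = {v}\<close>,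
  and the whole tower, \<open>K = lowest N\<close>.\<close>

lemma sl2_submodule_span_opR_powers:
  assumes "K \<subseteq> lowest N"
  shows "sl2_submodule (sl2_act i) (P.span (\<Union>l. (opR i ^^ l) ` K))" (is "_ (P.span ?S)")
proof (rule sl2_submodule_span)
  fix s assume "s \<in> ?S"
  then obtain l v where v: "v \<in> K" and s: "s = (opR i ^^ l) v" by blast
  have base: "(opR i ^^ l) v \<in> P.span ?S" for l using v by (blast intro: P.span_base)
  have low: "v \<in> lowest N" using v assms by blast
  show "opR i s \<in> P.span ?S" using base[of "Suc l"] by (simp add: s)
  show "opOmega s \<in> P.span ?S"
    unfolding s opOmega_opR_power[OF low] by (intro P.span_scale base)
  show "opL i s \<in> P.span ?S"
  proof (cases l)
    case 0
    then show ?thesis using low by (simp add: s lowest_def P.span_zero)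
  next
    case (Suc k)
    show ?thesis unfolding s Suc opL_opR_power[OF low] by (intro P.span_scale base)
  qed
qed

text \<open>A factor \<open>opR i\<close> moved across the form becomes \<open>opL i\<close> and
  lowers the other exponent by one, up to a scalar. For unequal exponents \<open>opL i\<close>
  finally meets a vector of its kernel; for equal ones \<open>herm u v\<close> is left.\<close>

lemma herm_opR_powers_eq_zero:
  assumes "u \<in> lowest N" "v \<in> lowest N" "herm u v = 0"
  shows "herm ((opR i ^^ l) u) ((opR i ^^ m) v) = 0"
proof (induction l arbitrary: m)
  case 0
  show ?case
  proof (cases m)
    case (Suc k)
    have "herm ((opR i ^^ m) v) u = 0"
      using assms(1) by (simp add: Suc herm_opR_left lowest_def)
    then show ?thesis by (subst herm_cnj) simp
  qed (simp add: assms(3))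
next
  case (Suc l)
  have *: "herm ((opR i ^^ Suc l) u) ((opR i ^^ m) v)
      = herm ((opR i ^^ l) u) (opL i ((opR i ^^ m) v))"
    by (simp add: herm_opR_left)
  show ?case
  proof (cases m)
    case 0
    then show ?thesis unfolding * using assms(2) by (simp add: lowest_def)
  next
    case (Suc k)
    show ?thesis unfolding * unfolding Suc opL_opR_power[OF assms(2)]
      by (simp add: herm_scale_right Suc.IH)
  qed
qed

lemma orthogonal_ladders:
  assumes "u \<in> lowest N" "v \<in> lowest N" "herm u v = 0" "p \<in> ladder u" "q \<in> ladder v"
  shows "herm p q = 0"
  using herm_span_eq_zero[OF _ assms(4)[unfolded ladder_def] assms(5)[unfolded ladder_def]]
    herm_opR_powers_eq_zero[OF assms(1-3)] by blast

section \<open>Ladders as irreducible submodules\<close>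

lemma self_in_ladder: "v \<in> ladder v"
  unfolding ladder_def by (rule P.span_base) (auto intro: image_eqI[of _ _ 0])

lemma sl2_submodule_ladder:
  assumes "v \<in> lowest N"
  shows "sl2_submodule (sl2_act i) (ladder v)"
  using sl2_submodule_span_opR_powers[of "{v}"] assms
  by (simp add: ladder_def UNION_singleton_eq_range)

text \<open>Modulo a multiple of \<open>v\<close>, an element of the ladder lies in the image of
  \<open>opR i\<close>. The remainder is then in this image and in the kernel of
  \<open>opL i\<close>, hence orthogonal to itself by adjointness, hence 0.\<close>

lemma ladder_kernel:
  assumes "v \<in> lowest N" "w \<in> ladder v" "opL i w = 0"
  obtains c where "w = scale c v"
proof -
  have "range (\<lambda>l. (opR i ^^ l) v) = insert v (opR i ` range (\<lambda>l. (opR i ^^ l) v))"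
  proof (intro equalityI subsetI)
    fix p assume "p \<in> range (\<lambda>l. (opR i ^^ l) v)"
    then obtain l where "p = (opR i ^^ l) v" by blast
    then show "p \<in> insert v (opR i ` range (\<lambda>l. (opR i ^^ l) v))"
      by (cases l) auto
  next
    fix p assume "p \<in> insert v (opR i ` range (\<lambda>l. (opR i ^^ l) v))"
    then consider "p = (opR i ^^ 0) v" | l where "p = (opR i ^^ Suc l) v" by auto
    then show "p \<in> range (\<lambda>l. (opR i ^^ l) v)" by cases blast+
  qed
  then have "w \<in> P.span (insert v (opR i ` range (\<lambda>l. (opR i ^^ l) v)))"
    using assms(2) unfolding ladder_def by metis
  then obtain c where "w - scale c v \<in> P.span (opR i ` range (\<lambda>l. (opR i ^^ l) v))"
    by (auto simp: P.span_insert)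
  then obtain f where f: "w - scale c v = opR i f"
    unfolding R.span_image by blast
  have "opL i (w - scale c v) = 0"
    using assms(1,3) by (simp add: L.diff L.scale lowest_def)
  then have "herm (w - scale c v) (w - scale c v) = 0"
    by (subst (1) f) (simp add: herm_opR_left)
  then have "w = scale c v" using herm_definite by fastforce
  then show ?thesis by (rule that)
qed

text \<open>\<open>opL i\<close> takes each rung to a multiple of the one below and kills the bottom
  one, so the number of rungs needed drops by one.\<close>

lemma opL_span_opR_powers:
  assumes "v \<in> lowest N" "w \<in> P.span ((\<lambda>l. (opR i ^^ l) v) ` {..<Suc n})"
  shows "opL i w \<in> P.span ((\<lambda>l. (opR i ^^ l) v) ` {..<n})"
  using assms(2)
proof (induction rule: P.span_induct_alt)
  case (step c x y)
  then obtain l where l: "l < Suc n" "x = (opR i ^^ l) v" by blast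
  have "opL i x \<in> P.span ((\<lambda>l. (opR i ^^ l) v) ` {..<n})"
  proof (cases l)
    case 0
    then show ?thesis using assms(1) l(2) by (simp add: lowest_def P.span_zero)
  next
    case (Suc k)
    with l show ?thesis unfolding l(2) Suc opL_opR_power[OF assms(1)]
      by (intro P.span_scale P.span_base) auto
  qed
  with step show ?case by (simp add: L.add L.scale P.span_add P.span_scale)
qed (simp add: L.zero P.span_zero)

lemma ladder_finite:
  assumes "w \<in> ladder v"
  obtains n where "w \<in> P.span ((\<lambda>l. (opR i ^^ l) v) ` {..<n})"
proof -
  have "\<exists>n. w \<in> P.span ((\<lambda>l. (opR i ^^ l) v) ` {..<n})"
    using assms unfolding ladder_def
  proof (induction rule: P.span_induct_alt)
    case base
    show ?case by (simp add: P.span_zero)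
  next
    case (step c x y)
    then obtain l n where l: "x = (opR i ^^ l) v" and n: "y \<in> P.span ((\<lambda>l. (opR i ^^ l) v) ` {..<n})"
      by blast
    have "y \<in> P.span ((\<lambda>l. (opR i ^^ l) v) ` {..<max (Suc l) n})"
      by (rule subsetD[OF P.span_mono n]) auto
    moreover have "x \<in> P.span ((\<lambda>l. (opR i ^^ l) v) ` {..<max (Suc l) n})"
      unfolding l by (rule P.span_base) auto
    ultimately show ?case by (blast intro: P.span_add P.span_scale)
  qed
  with that show ?thesis by blast
qed

text \<open>Induction on the number of rungs: if \<open>opL i w\<close> is nonzero, it is an element
  of \<open>W\<close> needing one rung fewer; otherwise \<open>w\<close> is a multiple of
  \<open>v\<close>. With no rungs the span is zero, contrary to \<open>w \<noteq> 0\<close>.\<close>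

lemma generator_in_submodule:
  assumes "v \<in> lowest N" "sl2_submodule (sl2_act i) W" "W \<subseteq> ladder v"
    and "w \<in> P.span ((\<lambda>l. (opR i ^^ l) v) ` {..<n})" "w \<in> W" "w \<noteq> 0"
  shows "v \<in> W"
  using assms(4-6)
proof (induction n arbitrary: w)
  case 0
  then show ?case by simp
next
  case (Suc n)
  show ?case
  proof (cases "opL i w = 0")
    case False
    with Suc.prems show ?thesis
      using Suc.IH opL_span_opR_powers[OF assms(1)] sl2_submodule_opL[OF assms(2)] by blast
  next
    case True
    with Suc.prems assms(3) obtain c where c: "w = scale c v"
      using ladder_kernel[OF assms(1)] by blast
    \<comment> \<open>Here \<open>c \<noteq> 0\<close> because \<open>w \<noteq> 0\<close>.\<close>
    then have "v = scale (inverse c) w" using Suc.prems(3) by auto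
    then show ?thesis using assms(2) Suc.prems(2)
      by (metis P.subspace_scale sl2_submodule_def)
  qed
qed

lemma irreducible_ladder:
  assumes "v \<in> lowest N" "v \<noteq> 0"
  shows "irreducible_sl2_submodule (sl2_act i) (ladder v)"
  unfolding irreducible_sl2_submodule_def
proof (intro conjI allI impI)
  show "sl2_submodule (sl2_act i) (ladder v)" by (rule sl2_submodule_ladder[OF assms(1)])
  show "ladder v \<noteq> {0}" using self_in_ladder[of v] assms(2) by auto
  fix W assume W: "sl2_submodule (sl2_act i) W" "W \<subseteq> ladder v"
  then have sub: "P.subspace W" by (simp add: sl2_submodule_def)
  show "W = {0} \<or> W = ladder v"
  proof (cases "W = {0}")
    case False
    then obtain w where w: "w \<in> W" "w \<noteq> 0" using P.subspace_0[OF sub] by blast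
    obtain n where "w \<in> P.span ((\<lambda>l. (opR i ^^ l) v) ` {..<n})"
      using w(1) W(2) ladder_finite by blast
    then have "v \<in> W" using generator_in_submodule[OF assms(1) W] w by blast
    then have "ladder v \<subseteq> W"
      unfolding ladder_def using sl2_submodule_opR_power[OF W(1)]
      by (intro P.span_minimal sub) blast
    with W(2) show ?thesis by blast
  qed simp
qed

section \<open>Decomposition of the tower into ladders\<close>

lemma kernel_tower_eq_span: "kernel_tower i N = P.span (\<Union>l. (opR i ^^ l) ` lowest N)"
  by (simp add: kernel_tower_def lowest_def)

text \<open>The powers of \<open>opR i\<close> are linear, so it suffices to apply them to a
  spanning set of \<open>lowest N\<close>.\<close>

lemma kernel_tower_eq_span_ladders:
  assumes "P.span T = lowest N"
  shows "kernel_tower i N = P.span (\<Union>(ladder ` T))"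
proof (rule antisym)
  have power_in: "(opR i ^^ l) p \<in> P.span (\<Union>(ladder ` T))" if "p \<in> P.span T" for l p
    using that
  proof (induction rule: P.span_induct_alt)
    case base
    have "(opR i ^^ l) 0 = 0" by (induction l) (simp_all add: R.zero)
    then show ?case by (simp add: P.span_zero)
  next
    case (step c x y)
    have "(opR i ^^ l) (scale c x + y) = scale c ((opR i ^^ l) x) + (opR i ^^ l) y"
      by (induction l) (simp_all add: R.add R.scale)
    moreover have "(opR i ^^ l) x \<in> ladder x"
      unfolding ladder_def by (rule P.span_base) blast
    ultimately show ?case using step
      by (auto intro!: P.span_add P.span_scale intro: P.span_base)
  qed
  then show "kernel_tower i N \<subseteq> P.span (\<Union>(ladder ` T))"
    unfolding kernel_tower_eq_span assms[symmetric] by (intro P.span_minimal P.subspace_span) blast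
  have "ladder t \<subseteq> kernel_tower i N" if "t \<in> T" for t
  proof -
    have "t \<in> lowest N" using that assms P.span_superset by blast
    then show ?thesis unfolding ladder_def kernel_tower_eq_span by (intro P.span_mono) blast
  qed
  then show "P.span (\<Union>(ladder ` T)) \<subseteq> kernel_tower i N"
    by (intro P.span_minimal) (auto simp: kernel_tower_def)
qed

end

text \<open>Orthogonality forces independence: pairing a vanishing sum with one of its terms leaves
  only the square norm of that term.\<close>

lemma orthogonal_direct_sumI:
  assumes "\<And>U. U \<in> \<U> \<Longrightarrow> P.subspace U" "V = P.span (\<Union>\<U>)"
    and orth: "\<And>U U' p q. U \<in> \<U> \<Longrightarrow> U' \<in> \<U> \<Longrightarrow> U \<noteq> U' \<Longrightarrow> p \<in> U \<Longrightarrow> q \<in> U' \<Longrightarrow> herm p q = 0"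
  shows "orthogonal_direct_sum V \<U>"
proof -
  have "u U = 0" if F: "finite F" "F \<subseteq> \<U>" "\<forall>U\<in>F. u U \<in> U" "(\<Sum>U\<in>F. u U) = 0" "U \<in> F" for F u U
  proof (rule herm_definite)
    have "0 = (\<Sum>X\<in>F. herm (u X) (u U))"
      using F(4) by (simp flip: herm_sum_fun_left)
    also have "\<dots> = (\<Sum>X\<in>F. if X = U then herm (u U) (u U) else 0)"
    proof (rule sum.cong)
      fix X assume "X \<in> F"
      then show "herm (u X) (u U) = (if X = U then herm (u U) (u U) else 0)"
        using orth[of X U "u X" "u U"] F(2,3,5) by auto
    qed simp
    finally show "herm (u U) (u U) = 0" using F(1,5) by simp
  qed
  then show ?thesis
    unfolding orthogonal_direct_sum_def internal_direct_sum_def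
    by (intro conjI allI impI ballI) (use assms in \<open>simp_all only:\<close>)
qed

theorem proposition13p22:
  fixes i N :: nat
  assumes "i \<in> {1, 2, 3}"
  shows "sl2_module (sl2_act i) \<and>
         sl2_submodule (sl2_act i) (kernel_tower i N) \<and>
         (\<exists>\<U>. (\<forall>U\<in>\<U>. irreducible_sl2_submodule (sl2_act i) U) \<and>
              orthogonal_direct_sum (kernel_tower i N) \<U>)"
proof -
  interpret sl2_index i by unfold_locales (rule assms)
  have "lowest N \<subseteq> homogeneous N" by (simp add: lowest_def)
  \<comment> \<open>The elements of \<open>T\<close> generate the summands;
    \<open>0 \<notin> T\<close> ensures that each ladder is nonzero, as irreducibility
    demands.\<close>
  then obtain T where T: "0 \<notin> T" "P.span T = lowest N"
    and orth: "\<And>s t. s \<in> T \<Longrightarrow> t \<in> T \<Longrightarrow> s \<noteq> t \<Longrightarrow> herm s t = 0"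
    using orthogonal_basis_homogeneous[OF subspace_lowest] by metis
  have T_lowest: "t \<in> lowest N" if "t \<in> T" for t
    using that T(2) P.span_base by blast
  have "irreducible_sl2_submodule (sl2_act i) U" if "U \<in> ladder ` T" for U
    using that T(1) T_lowest irreducible_ladder by blast
  moreover have "orthogonal_direct_sum (kernel_tower i N) (ladder ` T)"
  proof (rule orthogonal_direct_sumI)
    show "P.subspace U" if "U \<in> ladder ` T" for U
      using that by (auto simp: ladder_def)
    show "kernel_tower i N = P.span (\<Union>(ladder ` T))"
      by (rule kernel_tower_eq_span_ladders[OF T(2)])
    fix U U' p q assume "U \<in> ladder ` T" "U' \<in> ladder ` T" "U \<noteq> U'" "p \<in> U" "q \<in> U'"
    \<comment> \<open>Distinct ladders have distinct generators, which are therefore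
      orthogonal.\<close>
    then obtain s t where "s \<in> T" "t \<in> T" "s \<noteq> t" "p \<in> ladder s" "q \<in> ladder t" by blast
    then show "herm p q = 0" using orthogonal_ladders T_lowest orth by blast
  qed
  ultimately show ?thesis
    using sl2_module_act sl2_submodule_span_opR_powers[OF subset_refl]
    unfolding kernel_tower_eq_span by blast
qed

end
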